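(* Let $(X,d)$ be a compact metric space, let $f:X\to X$ be a continuous surjection, and let $\mathbb{F}=(f_n)_{n\in\mathbb{N}}$ be a sequence of continuous surjections $f_n:X\to X$ such that $f_n\circ f=f\circ f_n$ for every $n\in\mathbb{N}$. If $\sum_{n=1}^{\infty} D(f_n,f)<\infty$, then the set of pairs proximal for $(X,f)$ is dense in $X\times X$ if and only if the set of pairs proximal for $(X,\mathbb{F})$ is dense in $X\times X$.
   Context: $D(g,h)=\sup_{x\in X}d(g(x),h(x))$ for continuous self maps $g,h$ of $X$. For $\mathbb{F}=(f_n)_{n\in\mathbb{N}}$ (with $\mathbb{N}=\{1,2,\dots\}$), put $\omega_n=f_n\circ f_{n-1}\circ\cdots\circ f_1$. A pair $(x,y)\in X\times X$ is proximal for the non-autonomous system $(X,\mathbb{F})$ if $\liminf_{n\to\infty}d(\omega_n(x),\omega_n(y))=0$, and proximal for $(X,f)$ if $\liminf_{n\to\infty}d(f^n(x),f^n(y))=0$. *)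

theory Defs
  imports "HOL-Analysis.Analysis"
begin

text \<open>A compact metric space is a compact subset \<open>X\<close> of a metric type. Its self maps are total
  functions on that type, of which only the values on \<open>X\<close> matter.\<close>

text \<open>For compact \<open>X\<close> and continuous \<open>g\<close> and \<open>h\<close> the supremum is over a bounded set of reals; it is
  meaningful only for nonempty \<open>X\<close>.\<close>

definition sup_dist :: "'a::metric_space set \<Rightarrow> ('a \<Rightarrow> 'a) \<Rightarrow> ('a \<Rightarrow> 'a) \<Rightarrow> real" where
  "sup_dist X g h = (SUP x\<in>X. dist (g x) (h x))"

text \<open>\<open>omega F n = F n \<circ> \<dots> \<circ> F 1\<close>: the sequence of maps starts at index 1, and \<open>F 0\<close> is never used.\<close>

primrec omega :: "(nat \<Rightarrow> 'a \<Rightarrow> 'a) \<Rightarrow> nat \<Rightarrow> 'a \<Rightarrow> 'a" where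
  "omega F 0 = id"
| "omega F (Suc n) = F (Suc n) \<circ> omega F n"

text \<open>The limit inferior is taken in the complete lattice of extended reals.\<close>

definition proximal_pairs :: "'a::metric_space set \<Rightarrow> ('a \<Rightarrow> 'a) \<Rightarrow> ('a \<times> 'a) set" where
  "proximal_pairs X f =
    {(x, y) \<in> X \<times> X. liminf (\<lambda>n. ereal (dist ((f ^^ n) x) ((f ^^ n) y))) = 0}"

definition proximal_pairs_seq :: "'a::metric_space set \<Rightarrow> (nat \<Rightarrow> 'a \<Rightarrow> 'a) \<Rightarrow> ('a \<times> 'a) set" where
  "proximal_pairs_seq X F =
    {(x, y) \<in> X \<times> X. liminf (\<lambda>n. ereal (dist (omega F n x) (omega F n y))) = 0}"

definition dense_in :: "'a::topological_space set \<Rightarrow> 'a set \<Rightarrow> bool" where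
  "dense_in S A \<longleftrightarrow> A \<subseteq> S \<and> top_of_set S closure_of A = S"

end

theory Submission
  imports Defs
begin

text \<open>
  Commutation turns \<open>f ^^ n \<circ> F (Suc k)\<close> into \<open>F (Suc k) \<circ> f ^^ n\<close>, so replacing the maps
  \<open>F (k + 1), \<dots>, F (k + n)\<close> by \<open>f\<close> one at a time costs a single \<open>sup_dist X (F j) f\<close> each, and
  \<open>omega F (k + n)\<close> stays within a tail of the series of \<open>f ^^ n \<circ> omega F k\<close>, uniformly in \<open>n\<close>.
  Since \<open>f ^^ n \<circ> omega F k = omega F k \<circ> f ^^ n\<close> and \<open>omega F k\<close> is uniformly continuous,
  every pair proximal for \<open>f\<close> is proximal for \<open>F\<close>.
  Conversely, \<open>omega F k\<close> is onto, so it carries a dense set of pairs proximal for \<open>F\<close> to a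
  dense set of pairs whose \<open>f\<close>-orbits come infinitely often within a tail of each other; the
  pairs proximal for \<open>f\<close> are then a countable intersection of open dense sets, and the Baire
  category theorem applies.
\<close>

section \<open>Proximality as infinitely many close returns\<close>

lemma liminf_ereal_eq_0_iff:
  fixes a :: "nat \<Rightarrow> real"
  assumes nonneg: "\<And>n. 0 \<le> a n"
  shows "liminf (\<lambda>n. ereal (a n)) = 0 \<longleftrightarrow> (\<forall>e>0. \<exists>\<^sub>F n in sequentially. a n < e)"
proof (intro iffI allI impI)
  fix e :: real
  assume lim: "liminf (\<lambda>n. ereal (a n)) = 0" and e: "e > 0"
  show "\<exists>\<^sub>F n in sequentially. a n < e"
  proof (rule ccontr)
    assume "\<not> (\<exists>\<^sub>F n in sequentially. a n < e)"
    then have "\<forall>\<^sub>F n in sequentially. ereal e \<le> ereal (a n)"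
      by (simp add: not_frequently not_less)
    then have "ereal e \<le> liminf (\<lambda>n. ereal (a n))"
      by (rule Liminf_bounded)
    with lim e show False by simp
  qed
next
  assume freq: "\<forall>e>0. \<exists>\<^sub>F n in sequentially. a n < e"
  have "0 \<le> liminf (\<lambda>n. ereal (a n))"
    by (rule Liminf_bounded) (simp add: nonneg)
  moreover have "\<not> 0 < liminf (\<lambda>n. ereal (a n))"
  proof
    assume "0 < liminf (\<lambda>n. ereal (a n))"
    then obtain e where e: "0 < ereal e" "ereal e < liminf (\<lambda>n. ereal (a n))"
      using ereal_dense2 by blast
    then have "\<forall>\<^sub>F n in sequentially. ereal e < ereal (a n)"
      by (intro less_LiminfD)
    then have "\<forall>\<^sub>F n in sequentially. \<not> a n < e"
      by (rule eventually_mono) simp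
    with freq e(1) show False
      by (simp add: frequently_def)
  qed
  ultimately show "liminf (\<lambda>n. ereal (a n)) = 0"
    by (simp add: order_less_le)
qed

lemma mem_proximal_pairs_iff:
  "(x, y) \<in> proximal_pairs X f \<longleftrightarrow> x \<in> X \<and> y \<in> X \<and>
     (\<forall>e>0. \<exists>\<^sub>F n in sequentially. dist ((f ^^ n) x) ((f ^^ n) y) < e)"
  unfolding proximal_pairs_def by (simp add: liminf_ereal_eq_0_iff)

lemma mem_proximal_pairs_seq_iff:
  "(x, y) \<in> proximal_pairs_seq X F \<longleftrightarrow> x \<in> X \<and> y \<in> X \<and>
     (\<forall>e>0. \<exists>\<^sub>F n in sequentially. dist (omega F n x) (omega F n y) < e)"
  unfolding proximal_pairs_seq_def by (simp add: liminf_ereal_eq_0_iff)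

section \<open>Comparing the orbits of \<open>F\<close> with those of \<open>f\<close>\<close>

lemma dist_le_sup_dist:
  assumes "compact X" "continuous_on X g" "continuous_on X h" "x \<in> X"
  shows "dist (g x) (h x) \<le> sup_dist X g h"
proof -
  have "compact ((\<lambda>x. dist (g x) (h x)) ` X)"
    using assms by (intro compact_continuous_image continuous_intros)
  then show ?thesis
    unfolding sup_dist_def
    by (intro cSUP_upper assms bounded_imp_bdd_above compact_imp_bounded)
qed

lemma funpow_continuous_on:
  assumes "continuous_on X f" "f ` X \<subseteq> X"
  shows "continuous_on X (f ^^ n) \<and> (f ^^ n) ` X \<subseteq> X"
proof (induction n)
  case (Suc n)
  then have "continuous_on X (f \<circ> f ^^ n)"
    using assms by (intro continuous_on_compose) (auto intro: continuous_on_subset)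
  then show ?case
    using Suc assms by auto
qed simp

lemma omega_continuous_on:
  assumes "\<And>n. n \<ge> 1 \<Longrightarrow> continuous_on X (F n)" "\<And>n. n \<ge> 1 \<Longrightarrow> F n ` X = X"
  shows "continuous_on X (omega F n) \<and> omega F n ` X = X"
proof (induction n)
  case (Suc n)
  then have "continuous_on X (F (Suc n) \<circ> omega F n)"
    by (intro continuous_on_compose) (simp_all add: assms)
  then show ?case
    using Suc assms(2)[of "Suc n"] by (simp add: image_comp [symmetric] del: o_apply)
qed simp

lemma funpow_commute_on:
  assumes "f ` X \<subseteq> X" "\<And>x. x \<in> X \<Longrightarrow> g (f x) = f (g x)" "x \<in> X"
  shows "(f ^^ n) x \<in> X \<and> g ((f ^^ n) x) = (f ^^ n) (g x)"
  using assms by (induction n) auto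

lemma omega_commute:
  assumes "\<And>n. n \<ge> 1 \<Longrightarrow> F n ` X \<subseteq> X"
    and "\<And>n x. n \<ge> 1 \<Longrightarrow> x \<in> X \<Longrightarrow> F n (f x) = f (F n x)"
    and "x \<in> X"
  shows "omega F n x \<in> X \<and> omega F n (f x) = f (omega F n x)"
  using assms by (induction n) (auto simp: image_subset_iff)

text \<open>The induction replaces the earliest map \<open>F (Suc k)\<close> first, which is why
  \<open>k\<close> is arbitrary. Replacing the last one first would push the accumulated error
  through \<open>f\<close>, whose modulus of continuity would then enter; here commutation moves
  \<open>F (Suc k)\<close> to the outside, and the errors simply add up.\<close>

lemma dist_omega_funpow_le:
  assumes "compact X" and "continuous_on X f" and f: "f ` X \<subseteq> X"
    and "\<And>n. n \<ge> 1 \<Longrightarrow> continuous_on X (F n)"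
    and F: "\<And>n. n \<ge> 1 \<Longrightarrow> F n ` X \<subseteq> X"
    and comm: "\<And>n x. n \<ge> 1 \<Longrightarrow> x \<in> X \<Longrightarrow> F n (f x) = f (F n x)"
    and z: "z \<in> X"
  shows "dist (omega F (k + n) z) ((f ^^ n) (omega F k z))
           \<le> (\<Sum>j = k..<k + n. sup_dist X (F (Suc j)) f)"
proof (induction n arbitrary: k)
  case (Suc n)
  \<comment> \<open>\<open>F (Suc k) w\<close> is the comparison point of the induction hypothesis
    at \<open>Suc k\<close>, and \<open>f w\<close> is the one wanted at \<open>k\<close>; they
    differ by the new summand.\<close>
  define w where "w = (f ^^ n) (omega F k z)"
  have ok: "omega F k z \<in> X"
    using omega_commute[of F X f z k] F comm z by blast
  have w: "w \<in> X" and Fw: "F (Suc k) w = (f ^^ n) (omega F (Suc k) z)"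
    using funpow_commute_on[of f X "F (Suc k)" "omega F k z" n] f comm ok
    by (auto simp: w_def)
  have "dist (omega F (k + Suc n) z) (F (Suc k) w)
          \<le> (\<Sum>j = Suc k..<k + Suc n. sup_dist X (F (Suc j)) f)"
    using Suc[of "Suc k"] by (simp add: Fw)
  moreover have "dist (F (Suc k) w) (f w) \<le> sup_dist X (F (Suc k)) f"
    using assms w by (intro dist_le_sup_dist) auto
  ultimately have "dist (omega F (k + Suc n) z) (f w)
      \<le> sup_dist X (F (Suc k)) f + (\<Sum>j = Suc k..<k + Suc n. sup_dist X (F (Suc j)) f)"
    by (smt (verit) dist_triangle)
  also have "\<dots> = (\<Sum>j = k..<k + Suc n. sup_dist X (F (Suc j)) f)"
    by (rule sum.atLeast_Suc_lessThan [symmetric]) simp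
  finally show ?case
    by (simp add: w_def)
qed simp

section \<open>Density of proximal pairs by Baire category\<close>

text \<open>In \<open>near\<close> the pair may change with \<open>e\<close>, so no proximal pair is
  given directly. For each scale, having a late close return is an open condition and
  \<open>near\<close> makes it dense; Baire category combines the scales.\<close>

lemma dense_in_proximal_pairs:
  assumes X: "compact X" and f: "continuous_on X f" "f ` X \<subseteq> X"
    and near: "\<And>e U. e > 0 \<Longrightarrow> openin (top_of_set (X \<times> X)) U \<Longrightarrow> U \<noteq> {} \<Longrightarrow>
      \<exists>(x, y) \<in> U. \<exists>\<^sub>F n in sequentially. dist ((f ^^ n) x) ((f ^^ n) y) < e"
  shows "dense_in (X \<times> X) (proximal_pairs X f)"
proof -
  let ?T = "top_of_set (X \<times> X)"
  define d where "d n p = dist ((f ^^ n) (fst p)) ((f ^^ n) (snd p))" for n p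
  \<comment> \<open>One index \<open>N\<close> bounds the return time from below and the distance
    from above, so a single countable family suffices.\<close>
  define G where "G N = {p \<in> X \<times> X. \<exists>n\<ge>N. d n p < inverse (Suc N)}" for N :: nat
  have d: "continuous_on (X \<times> X) (d n)" for n
  proof -
    have "continuous_on (X \<times> X) (\<lambda>p. (f ^^ n) (fst p))"
         "continuous_on (X \<times> X) (\<lambda>p. (f ^^ n) (snd p))"
      using funpow_continuous_on[OF f, of n]
      by (auto intro!: continuous_on_compose2[of X "f ^^ n"] continuous_intros)
    then show ?thesis
      unfolding d_def by (rule continuous_on_dist)
  qed
  have "openin ?T (G N)" for N
  proof -
    have "openin ?T ((X \<times> X) \<inter> d n -` {..<inverse (Suc N)})" for n
      using d by (rule continuous_openin_preimage_gen) simp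
    then have "openin ?T (\<Union>n\<in>{N..}. (X \<times> X) \<inter> d n -` {..<inverse (Suc N)})"
      by (intro openin_Union) auto
    also have "(\<Union>n\<in>{N..}. (X \<times> X) \<inter> d n -` {..<inverse (Suc N)}) = G N"
      by (auto simp: G_def)
    finally show ?thesis .
  qed
  moreover have "?T closure_of G N = topspace ?T" for N
    unfolding dense_intersects_open
  proof (intro allI impI, elim conjE)
    fix U assume U: "openin ?T U" "U \<noteq> {}"
    obtain x y where xy: "(x, y) \<in> U"
      "\<exists>\<^sub>F n in sequentially. dist ((f ^^ n) x) ((f ^^ n) y) < inverse (Suc N)"
      using near[OF _ U, of "inverse (Suc N)"] by auto
    then have "(x, y) \<in> G N"
      using openin_imp_subset[OF U(1)] by (auto simp: G_def d_def frequently_sequentially)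
    with xy show "G N \<inter> U \<noteq> {}" by blast
  qed
  moreover have "locally_compact_space ?T \<and> regular_space ?T"
  proof
    have "compact_space ?T"
      using X by (simp add: compact_space_subtopology compact_Times)
    then show "locally_compact_space ?T"
      by (rule compact_imp_locally_compact_space)
    show "regular_space ?T"
      by (intro regular_space_subtopology metrizable_imp_regular_space metrizable_space_euclidean)
  qed
  ultimately have "?T closure_of (\<Inter>(range G)) = topspace ?T"
    by (intro Baire_category) auto
  also have "\<Inter>(range G) = proximal_pairs X f"
  proof (intro set_eqI iffI; clarify)
    fix x y assume xy: "(x, y) \<in> \<Inter>(range G)"
    show "(x, y) \<in> proximal_pairs X f"
      unfolding mem_proximal_pairs_iff
    proof (intro conjI allI impI)
      show "x \<in> X" "y \<in> X"
        using xy by (auto simp: G_def)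
      fix e :: real assume "e > 0"
      then obtain M where M: "inverse (Suc M) < e"
        using reals_Archimedean by blast
      show "\<exists>\<^sub>F n in sequentially. dist ((f ^^ n) x) ((f ^^ n) y) < e"
        unfolding frequently_sequentially
      proof
        fix N
        \<comment> \<open>The index \<open>max M N\<close> meets both demands: distance below
          \<open>e\<close> by \<open>M\<close>, time at least \<open>N\<close>.\<close>
        have "(x, y) \<in> G (max M N)" using xy by blast
        then obtain n where n: "n \<ge> max M N" "d n (x, y) < inverse (Suc (max M N))"
          by (auto simp: G_def)
        have "inverse (Suc (max M N)) \<le> inverse (real (Suc M))"
          by (intro le_imp_inverse_le) auto
        with n(2) M have "d n (x, y) < e" by linarith
        with n(1) show "\<exists>n\<ge>N. dist ((f ^^ n) x) ((f ^^ n) y) < e"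
          by (intro exI[of _ n]) (simp add: d_def)
      qed
    qed
  next
    fix x y N assume "(x, y) \<in> proximal_pairs X f"
    then show "(x, y) \<in> G N"
      unfolding mem_proximal_pairs_iff G_def d_def frequently_sequentially by simp
  qed
  finally show ?thesis
    by (auto simp: dense_in_def proximal_pairs_def)
qed

section \<open>The two implications\<close>

theorem proposition13:
  fixes X :: "'a::metric_space set"
    and f :: "'a \<Rightarrow> 'a"
    and F :: "nat \<Rightarrow> 'a \<Rightarrow> 'a"
  assumes "compact X"
    and "continuous_on X f" and "f ` X = X"
    and "\<And>n. n \<ge> 1 \<Longrightarrow> continuous_on X (F n)"
    and "\<And>n. n \<ge> 1 \<Longrightarrow> F n ` X = X"
    and "\<And>n x. n \<ge> 1 \<Longrightarrow> x \<in> X \<Longrightarrow> F n (f x) = f (F n x)"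
    and "summable (\<lambda>n. sup_dist X (F (Suc n)) f)"
  shows "dense_in (X \<times> X) (proximal_pairs X f) \<longleftrightarrow>
         dense_in (X \<times> X) (proximal_pairs_seq X F)"
proof -
  let ?T = "top_of_set (X \<times> X)"
  \<comment> \<open>The Cauchy criterion makes all blocks of the series starting at \<open>k\<close>
    small, so \<open>k\<close> depends on \<open>e\<close> alone, not on \<open>n\<close> or
    \<open>z\<close>.\<close>
  have close: "\<exists>k. \<forall>n. \<forall>z\<in>X. dist (omega F (k + n) z) ((f ^^ n) (omega F k z)) < e"
    if "e > 0" for e
  proof -
    obtain k where k: "\<And>n. norm (\<Sum>j = k..<n. sup_dist X (F (Suc j)) f) < e"
      using assms(7) \<open>e > 0\<close> unfolding summable_Cauchy by blast
    have "dist (omega F (k + n) z) ((f ^^ n) (omega F k z)) < e" if "z \<in> X" for n z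
    proof -
      have "dist (omega F (k + n) z) ((f ^^ n) (omega F k z))
              \<le> (\<Sum>j = k..<k + n. sup_dist X (F (Suc j)) f)"
        using assms(1-6) that by (intro dist_omega_funpow_le) auto
      also have "\<dots> < e"
        using k[of "k + n"] by (simp add: abs_less_iff)
      finally show ?thesis .
    qed
    then show ?thesis by blast
  qed
  have omega: "continuous_on X (omega F k)" "omega F k ` X = X" for k
    using omega_continuous_on[of X F k] assms by auto
  show ?thesis
  proof
    assume dense: "dense_in (X \<times> X) (proximal_pairs X f)"
    \<comment> \<open>This direction holds pair by pair, and density passes to the larger
      set.\<close>
    have "proximal_pairs X f \<subseteq> proximal_pairs_seq X F"
    proof clarify
      fix x y assume xy: "(x, y) \<in> proximal_pairs X f"
      then have X: "x \<in> X" "y \<in> X" by (auto simp: mem_proximal_pairs_iff)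
      have "\<exists>\<^sub>F n in sequentially. dist (omega F n x) (omega F n y) < e" if "e > 0" for e
      proof -
        obtain k where
          k: "\<And>n z. z \<in> X \<Longrightarrow> dist (omega F (k + n) z) ((f ^^ n) (omega F k z)) < e / 3"
          using close[of "e / 3"] \<open>e > 0\<close> by auto
        \<comment> \<open>With \<open>k\<close> already fixed, a return of the
          \<open>f\<close>-orbits within \<open>r\<close> at time \<open>n\<close> becomes one of
          the \<open>F\<close>-orbits within \<open>e\<close> at time \<open>k + n\<close>: one
          third of \<open>e\<close> comes from \<open>omega F k\<close>, two from
          \<open>close\<close>.\<close>
        have "uniformly_continuous_on X (omega F k)"
          using omega(1) assms(1) by (rule compact_uniformly_continuous)
        then obtain r where r: "r > 0"
          "\<And>u v. u \<in> X \<Longrightarrow> v \<in> X \<Longrightarrow> dist u v < r \<Longrightarrow> dist (omega F k u) (omega F k v) < e / 3"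
          unfolding uniformly_continuous_on_def using \<open>e > 0\<close>
          by (metis divide_pos_pos zero_less_numeral)
        have *: "dist (omega F (k + n) x) (omega F (k + n) y) < e"
          if n: "dist ((f ^^ n) x) ((f ^^ n) y) < r" for n
        proof -
          have c: "(f ^^ n) z \<in> X \<and> omega F k ((f ^^ n) z) = (f ^^ n) (omega F k z)"
            if "z \<in> X" for z
            using that assms omega_commute[of F X f _ k]
            by (intro funpow_commute_on) auto
          have "dist ((f ^^ n) (omega F k x)) ((f ^^ n) (omega F k y)) < e / 3"
            using r(2)[OF _ _ n] c X by auto
          with k[OF X(1), of n] k[OF X(2), of n] show ?thesis
            by metric
        qed
        show ?thesis
          unfolding frequently_sequentially
        proof
          fix N
          obtain n where "n \<ge> N" "dist ((f ^^ n) x) ((f ^^ n) y) < r"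
            using xy r(1) unfolding mem_proximal_pairs_iff frequently_sequentially by blast
          with * show "\<exists>m\<ge>N. dist (omega F m x) (omega F m y) < e"
            by (intro exI[of _ "k + n"]) simp
        qed
      qed
      with X show "(x, y) \<in> proximal_pairs_seq X F"
        by (simp add: mem_proximal_pairs_seq_iff)
    qed
    moreover have "proximal_pairs_seq X F \<subseteq> X \<times> X"
      by (auto simp: proximal_pairs_seq_def)
    ultimately show "dense_in (X \<times> X) (proximal_pairs_seq X F)"
      using dense closure_of_mono[of "proximal_pairs X f" "proximal_pairs_seq X F" ?T]
        closure_of_subset_topspace[of ?T "proximal_pairs_seq X F"]
      by (simp add: dense_in_def subset_antisym)
  next
    assume dense: "dense_in (X \<times> X) (proximal_pairs_seq X F)"
    show "dense_in (X \<times> X) (proximal_pairs X f)"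
    \<comment> \<open>Here only the image of a pair under \<open>omega F k\<close> is controlled,
      with \<open>k\<close> depending on \<open>e\<close>; hence the detour through Baire
      category.\<close>
    proof (rule dense_in_proximal_pairs)
      fix e :: real and U
      assume e: "e > 0" and U: "openin ?T U" "U \<noteq> {}"
      obtain k where
        k: "\<And>n z. z \<in> X \<Longrightarrow> dist (omega F (k + n) z) ((f ^^ n) (omega F k z)) < e / 3"
        using close[of "e / 3"] e by auto
      define h where "h p = (omega F k (fst p), omega F k (snd p))" for p
      \<comment> \<open>Pulling \<open>U\<close> back along \<open>h\<close> lets density be applied
        before time \<open>k\<close>; \<open>V\<close> is nonempty because \<open>h\<close> is
        onto.\<close>
      define V where "V = (X \<times> X) \<inter> h -` U"
      have "continuous_on (X \<times> X) h"
        unfolding h_def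
        by (intro continuous_on_Pair continuous_on_compose2[OF omega(1)[of k]] continuous_intros) auto
      moreover have h: "h ` (X \<times> X) = X \<times> X"
      proof -
        have "h ` (X \<times> X) = omega F k ` X \<times> omega F k ` X"
          by (force simp: h_def image_iff)
        then show ?thesis by (simp add: omega)
      qed
      ultimately have "openin ?T V"
        unfolding V_def using U(1)
        by (intro continuous_openin_preimage[where T = "X \<times> X"]) auto
      moreover have "V \<noteq> {}"
      proof -
        obtain q where "q \<in> U" using U(2) by blast
        moreover then obtain p where "p \<in> X \<times> X" "q = h p"
          using openin_imp_subset[OF U(1)] h by blast
        ultimately show ?thesis by (auto simp: V_def)
      qed
      ultimately have "proximal_pairs_seq X F \<inter> V \<noteq> {}"
        using dense dense_intersects_open[of ?T "proximal_pairs_seq X F"]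
        by (simp add: dense_in_def)
      then obtain x y where xy: "(x, y) \<in> proximal_pairs_seq X F" "(x, y) \<in> V"
        by (metis IntE equals0I surj_pair)
      then have X: "x \<in> X" "y \<in> X" by (auto simp: V_def)
      have "\<exists>\<^sub>F n in sequentially.
          dist ((f ^^ n) (omega F k x)) ((f ^^ n) (omega F k y)) < e"
        unfolding frequently_sequentially
      proof
        fix N
        \<comment> \<open>Asking for \<open>m\<close> beyond \<open>k + N\<close> allows writing
          \<open>m = k + n\<close> with \<open>n\<close> at least \<open>N\<close>.\<close>
        have "\<exists>m\<ge>k + N. dist (omega F m x) (omega F m y) < e / 3"
          using xy(1) e unfolding mem_proximal_pairs_seq_iff frequently_sequentially
          by (metis divide_pos_pos zero_less_numeral)
        then obtain n where "n \<ge> N" "dist (omega F (k + n) x) (omega F (k + n) y) < e / 3"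
          by (auto simp: le_iff_add add.assoc)
        moreover with k[OF X(1), of n] k[OF X(2), of n]
        have "dist ((f ^^ n) (omega F k x)) ((f ^^ n) (omega F k y)) < e"
          by metric
        ultimately show "\<exists>n\<ge>N. dist ((f ^^ n) (omega F k x)) ((f ^^ n) (omega F k y)) < e"
          by blast
      qed
      moreover have "(omega F k x, omega F k y) \<in> U"
        using xy(2) by (simp add: V_def h_def)
      ultimately show "\<exists>(x, y)\<in>U. \<exists>\<^sub>F n in sequentially. dist ((f ^^ n) x) ((f ^^ n) y) < e"
        by blast
    qed (use assms in auto)
  qed
qed

end
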